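(* Let $a$ and $b$ be nonnegative integers and let $n\ge 1$. Let $\mathcal{S}_n$ be the set of all lattice paths from $(0,0)$ to $(n,an+b)$ that never go above the line $y=ax+b$, and let $$A_n(q)=\sum_{\tau\in\mathcal{S}_n} q^{\mathrm{Area}(\tau)},$$ where $\mathrm{Area}(\tau)$ denotes the area of the region between the line $y=ax+b$ and the path $\tau$ over $0\le x\le n$. Then $$A_n(q)=q^{\frac{1}{2}a n}\sum_{c_1=0}^{b}\;\sum_{c_2=0}^{c_1+a}\;\sum_{c_3=0}^{c_2+a}\cdots\sum_{c_n=0}^{c_{n-1}+a} q^{c_1+c_2+\cdots+c_{n}}.$$ In particular, the number $A_n$ of paths in $\mathcal{S}_n$ equals the number of integer sequences $(c_1,\ldots,c_n)$ such that $0\le c_1\le b$ and $0\le c_{i+1}\le c_i+a$ for $i=1,\ldots,n-1$.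
   Context: A lattice path is a sequence of unit steps, each being a right step $(1,0)$ or an up step $(0,1)$. Paths are allowed to touch the line $y=ax+b$. Explicitly, if $y_i$ is the height of the horizontal step of $\tau$ over the interval $i-1\le x\le i$, then $\mathrm{Area}(\tau)=\sum_{i=1}^n\int_{i-1}^{i}(ax+b-y_i)\,dx$. The expression $A_n(q)$ is a polynomial in $q^{1/2}$. *)

theory Defs
  imports "HOL-Analysis.Analysis" "HOL-Library.Poly_Mapping"
begin

datatype step = Right | Up

definition vertex :: "step list \<Rightarrow> nat \<Rightarrow> nat \<times> nat" where
  "vertex \<tau> k = (count_list (take k \<tau>) Right, count_list (take k \<tau>) Up)"

text \<open>The half-plane below the line is convex, so a path stays in it as soon as all its
  vertices do. Touching the line is allowed.\<close>

definition weakly_below :: "nat \<Rightarrow> nat \<Rightarrow> step list \<Rightarrow> bool" where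
  "weakly_below a b \<tau> \<longleftrightarrow>
     (\<forall>k\<le>length \<tau>. snd (vertex \<tau> k) \<le> a * fst (vertex \<tau> k) + b)"

definition paths :: "nat \<Rightarrow> nat \<Rightarrow> nat \<Rightarrow> step list set" where
  "paths a b n =
     {\<tau>. vertex \<tau> (length \<tau>) = (n, a * n + b) \<and> weakly_below a b \<tau>}"

text \<open>Heights of the successive horizontal steps of a path starting at height \<open>y\<close>.\<close>

fun horizontal_heights :: "nat \<Rightarrow> step list \<Rightarrow> nat list" where
  "horizontal_heights y [] = []"
| "horizontal_heights y (Right # \<tau>) = y # horizontal_heights y \<tau>"
| "horizontal_heights y (Up # \<tau>) = horizontal_heights (Suc y) \<tau>"

text \<open>For a path from the origin, the horizontal step over \<open>[i - 1, i]\<close> is the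
  \<open>i\<close>-th one; list positions start at 0.\<close>

definition area :: "nat \<Rightarrow> nat \<Rightarrow> nat \<Rightarrow> step list \<Rightarrow> real" where
  "area a b n \<tau> =
     (\<Sum>i=1..n. integral {real i - 1..real i}
        (\<lambda>x. real a * x + real b - real (horizontal_heights 0 \<tau> ! (i - 1))))"

text \<open>The indeterminate \<open>q\<close> is formal: areas are half-integers, so the generating function
  is taken in the ring of finite integer combinations of formal powers of \<open>q\<close> with real
  exponents, which contains the polynomials in \<open>q\<^sup>1\<^sup>/\<^sup>2\<close>.\<close>

definition qpow :: "real \<Rightarrow> (real \<Rightarrow>\<^sub>0 int)" where
  "qpow r = Poly_Mapping.single r 1"

definition area_gf :: "nat \<Rightarrow> nat \<Rightarrow> nat \<Rightarrow> (real \<Rightarrow>\<^sub>0 int)" where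
  "area_gf a b n = (\<Sum>\<tau>\<in>paths a b n. qpow (area a b n \<tau>))"

text \<open>\<open>nested_sum a n u F\<close> is the \<open>n\<close>-fold sum over
  \<open>0 \<le> c\<^sub>1 \<le> u\<close>, \<open>0 \<le> c\<^sub>2 \<le> c\<^sub>1 + a\<close>, \<dots>,
  \<open>0 \<le> c\<^sub>n \<le> c\<^bsub>n-1\<^esub> + a\<close> of \<open>F [c\<^sub>1, \<dots>, c\<^sub>n]\<close>.\<close>

primrec nested_sum ::
  "nat \<Rightarrow> nat \<Rightarrow> nat \<Rightarrow> (nat list \<Rightarrow> 'r::comm_monoid_add) \<Rightarrow> 'r" where
  "nested_sum a 0 u F = F []"
| "nested_sum a (Suc n) u F = (\<Sum>c=0..u. nested_sum a n (c + a) (\<lambda>cs. F (c # cs)))"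

text \<open>Integer sequences \<open>(c\<^sub>1, \<dots>, c\<^sub>n)\<close>, with \<open>c\<^sub>i\<close> stored at list position \<open>i - 1\<close>.\<close>

definition admissible_seqs :: "nat \<Rightarrow> nat \<Rightarrow> nat \<Rightarrow> int list set" where
  "admissible_seqs a b n =
     {c. length c = n \<and> 0 \<le> c ! 0 \<and> c ! 0 \<le> int b \<and>
         (\<forall>i\<in>{1..n - 1}. 0 \<le> c ! i \<and> c ! i \<le> c ! (i - 1) + int a)}"

end

(* Read a path through its slack, the vertical distance from the current vertex up to the line
   y = ax + b: it starts at b and ends at 0, an up step lowers it by 1 (so it must be positive),
   and a right step raises it by a. Recording the slack c_i just before the i-th right step is a
   bijection onto the sequences with c_1 <= b and c_(i+1) <= c_i + a, since between two
   consecutive right steps the slack can only drop. The strip of the region over [i - 1, i] has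
   area c_i + a/2. *)

theory Submission
  imports Defs
begin

text \<open>\<open>n\<close> counts the right steps still to come and \<open>u\<close> is the
  current slack. The guard \<open>0 < u\<close> keeps the path from crossing the line and makes
  \<open>u - 1\<close> a true difference.\<close>

fun slack_path :: "nat \<Rightarrow> nat \<Rightarrow> nat \<Rightarrow> step list \<Rightarrow> bool" where
  "slack_path a n u [] \<longleftrightarrow> n = 0 \<and> u = 0"
| "slack_path a n u (Up # \<tau>) \<longleftrightarrow> 0 < u \<and> slack_path a n (u - 1) \<tau>"
| "slack_path a n u (Right # \<tau>) \<longleftrightarrow> 0 < n \<and> slack_path a (n - 1) (u + a) \<tau>"

fun slacks :: "nat \<Rightarrow> nat \<Rightarrow> step list \<Rightarrow> nat list" where
  "slacks a u [] = []"
| "slacks a u (Up # \<tau>) = slacks a (u - 1) \<tau>"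
| "slacks a u (Right # \<tau>) = u # slacks a (u + a) \<tau>"

fun slack_seq :: "nat \<Rightarrow> nat \<Rightarrow> nat list \<Rightarrow> bool" where
  "slack_seq a u [] \<longleftrightarrow> True"
| "slack_seq a u (c # cs) \<longleftrightarrow> c \<le> u \<and> slack_seq a (c + a) cs"

text \<open>Inverse of \<open>slacks\<close>: the slack drops from \<open>u\<close> to
  \<open>c\<close> only by a run of \<open>u - c\<close> up steps, and after the last right step the
  whole remaining slack must be climbed.\<close>

fun path_of_slacks :: "nat \<Rightarrow> nat \<Rightarrow> nat list \<Rightarrow> step list" where
  "path_of_slacks a u [] = replicate u Up"
| "path_of_slacks a u (c # cs) = replicate (u - c) Up @ Right # path_of_slacks a (c + a) cs"

definition slack_seqs :: "nat \<Rightarrow> nat \<Rightarrow> nat \<Rightarrow> nat list set" where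
  "slack_seqs a n u = {cs. length cs = n \<and> slack_seq a u cs}"

lemma all_le_Suc_iff: "(\<forall>k\<le>Suc m. P k) \<longleftrightarrow> P 0 \<and> (\<forall>k\<le>m. P (Suc k))"
  by (metis Suc_le_mono le0 not0_implies_Suc)

text \<open>Removing the first step moves the origin to the next vertex, where the intercept of the
  line is the new slack. In the prefix condition this means splitting off \<open>k = 0\<close>, as
  in \<open>all_le_Suc_iff\<close>.\<close>

lemma slack_path_iff:
  "slack_path a n u \<tau> \<longleftrightarrow>
     count_list \<tau> Right = n \<and> count_list \<tau> Up = a * n + u \<and>
     (\<forall>k\<le>length \<tau>. count_list (take k \<tau>) Up \<le> a * count_list (take k \<tau>) Right + u)"
proof (induction a n u \<tau> rule: slack_path.induct)
  case (1 a n u)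
  then show ?case by auto
next
  case (2 a n u \<tau>)
  show ?case
  proof (cases u)
    case 0
    then show ?thesis by (auto simp: all_le_Suc_iff)
  next
    case (Suc v)
    then show ?thesis using 2 by (auto simp: all_le_Suc_iff)
  qed
next
  case (3 a n u \<tau>)
  show ?case
  proof (cases n)
    case 0
    then show ?thesis by auto
  next
    case (Suc m)
    then show ?thesis using 3 by (auto simp: all_le_Suc_iff algebra_simps)
  qed
qed

lemma paths_eq_slack_path: "paths a b n = {\<tau>. slack_path a n b \<tau>}"
  unfolding paths_def weakly_below_def vertex_def slack_path_iff by auto

text \<open>The first entry \<open>c\<close> is at most \<open>u\<close>, so
  \<open>Suc u - c = Suc (u - c)\<close> and the first run of up steps grows by one.\<close>

lemma path_of_slacks_Suc:
  "slack_seq a u cs \<Longrightarrow> path_of_slacks a (Suc u) cs = Up # path_of_slacks a u cs"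
  by (cases cs) (auto simp: Suc_diff_le)

lemma slack_seq_mono: "slack_seq a u cs \<Longrightarrow> u \<le> v \<Longrightarrow> slack_seq a v cs"
  by (cases cs) auto

lemma slacks_of_slack_path:
  assumes "slack_path a n u \<tau>"
  shows "slack_seq a u (slacks a u \<tau>)" and "length (slacks a u \<tau>) = n"
    and "path_of_slacks a u (slacks a u \<tau>) = \<tau>"
proof -
  have "slack_seq a u (slacks a u \<tau>) \<and> length (slacks a u \<tau>) = n \<and>
        path_of_slacks a u (slacks a u \<tau>) = \<tau>"
    using assms
  proof (induction a n u \<tau> rule: slack_path.induct)
    case (2 a n u \<tau>)
    then obtain v where "u = Suc v" by (cases u) auto
    \<comment> \<open>The hypothesis concerns the tail, read from slack \<open>v\<close>:
      monotonicity relaxes the bound to \<open>Suc v\<close>, and the leading \<open>Up\<close> is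
      restored by \<open>path_of_slacks_Suc\<close>.\<close>
    with 2 show ?case by (auto simp: path_of_slacks_Suc intro: slack_seq_mono)
  qed auto
  then show "slack_seq a u (slacks a u \<tau>)" "length (slacks a u \<tau>) = n"
    "path_of_slacks a u (slacks a u \<tau>) = \<tau>" by auto
qed

lemma slack_path_replicate_Up:
  "k \<le> u \<Longrightarrow> slack_path a n u (replicate k Up @ \<tau>) \<longleftrightarrow> slack_path a n (u - k) \<tau>"
  by (induction k arbitrary: u) auto

lemma slacks_replicate_Up:
  "slacks a u (replicate k Up @ \<tau>) = slacks a (u - k) \<tau>"
  by (induction k arbitrary: u) auto

lemma slack_path_path_of_slacks:
  "slack_seq a u cs \<Longrightarrow> slack_path a (length cs) u (path_of_slacks a u cs)"
  \<comment> \<open>The instance with the empty rest serves the final run of up steps, after which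
    nothing is appended.\<close>
  by (induction a u cs rule: slack_seq.induct)
     (use slack_path_replicate_Up[where \<tau> = "[]"] in \<open>auto simp: slack_path_replicate_Up\<close>)

lemma slacks_path_of_slacks:
  "slack_seq a u cs \<Longrightarrow> slacks a u (path_of_slacks a u cs) = cs"
  by (induction a u cs rule: slack_seq.induct)
     (use slacks_replicate_Up[where \<tau> = "[]"] in \<open>auto simp: slacks_replicate_Up\<close>)

lemma bij_betw_slacks: "bij_betw (slacks a b) (paths a b n) (slack_seqs a n b)"
  by (rule bij_betw_byWitness[where f' = "path_of_slacks a b"])
     (auto simp: paths_eq_slack_path slack_seqs_def slacks_of_slack_path
        slack_path_path_of_slacks slacks_path_of_slacks)

lemma slack_seqs_Suc:
  "slack_seqs a (Suc n) u = (\<lambda>(c, cs). c # cs) ` (SIGMA c:{0..u}. slack_seqs a n (c + a))"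
  by (force simp: slack_seqs_def length_Suc_conv image_iff)

lemma finite_slack_seqs: "finite (slack_seqs a n u)"
proof (induction n arbitrary: u)
  case 0
  then show ?case by (simp add: slack_seqs_def)
next
  case (Suc n)
  then show ?case by (auto simp: slack_seqs_Suc)
qed

text \<open>Flattens the dependent summation bounds into one index set, over which the bijection
  with paths can reindex.\<close>

lemma nested_sum_eq_sum: "nested_sum a n u F = sum F (slack_seqs a n u)"
proof (induction n arbitrary: u F)
  case 0
  have "slack_seqs a 0 u = {[]}" by (auto simp: slack_seqs_def)
  then show ?case by simp
next
  case (Suc n)
  have "inj_on (\<lambda>(c, cs). c # cs) A" for A :: "(nat \<times> nat list) set"
    by (auto simp: inj_on_def)
  then show ?case
    by (simp add: Suc slack_seqs_Suc sum.reindex sum.Sigma finite_slack_seqs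
          case_prod_unfold comp_def)
qed

text \<open>Invariant: at a vertex in column \<open>j\<close>, height plus slack is the height of
  the line. An up step trades one for the other; a right step adds \<open>a\<close> to both
  sides.\<close>

lemma horizontal_heights_plus_slack:
  assumes "slack_path a n u \<tau>" and "y + u = a * j + b" and "i < n"
  shows "horizontal_heights y \<tau> ! i + slacks a u \<tau> ! i = a * (j + i) + b"
  using assms
proof (induction a n u \<tau> arbitrary: y j i rule: slack_path.induct)
  case (3 a n u \<tau>)
  show ?case
  proof (cases i)
    case (Suc k)
    have "horizontal_heights y \<tau> ! k + slacks a (u + a) \<tau> ! k = a * (Suc j + k) + b"
      using 3 Suc by (intro "3.IH") (auto simp: algebra_simps)
    then show ?thesis using Suc by simp
  qed (use 3 in simp)
qed auto

text \<open>Written as the distance at the left end, where the slack is recorded, plus the triangle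
  of area \<open>p / 2\<close>.\<close>

lemma integral_linear_unit_interval:
  "integral {t - 1..t} (\<lambda>x. p * x + r - s) = p * (t - 1) + r - s + p / (2::real)"
proof -
  have "((\<lambda>x. p * x + r - s) has_integral
          (p * t^2 / 2 + (r - s) * t) - (p * (t - 1)^2 / 2 + (r - s) * (t - 1))) {t - 1..t}"
    by (rule fundamental_theorem_of_calculus)
       (auto intro!: derivative_eq_intros simp flip: has_real_derivative_iff_has_vector_derivative)
  then have "integral {t - 1..t} (\<lambda>x. p * x + r - s) =
      (p * t^2 / 2 + (r - s) * t) - (p * (t - 1)^2 / 2 + (r - s) * (t - 1))"
    by (rule integral_unique)
  then show ?thesis by (simp add: field_simps power2_eq_square)
qed

lemma area_eq:
  assumes "\<tau> \<in> paths a b n"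
  shows "area a b n \<tau> = 1 / 2 * real a * real n + real (sum_list (slacks a b \<tau>))"
proof -
  have path: "slack_path a n b \<tau>" using assms by (simp add: paths_eq_slack_path)
  have strip: "integral {real i - 1..real i}
          (\<lambda>x. real a * x + real b - real (horizontal_heights 0 \<tau> ! (i - 1))) =
        real (slacks a b \<tau> ! (i - 1)) + real a / 2" if "i \<in> {1..n}" for i
  proof -
    \<comment> \<open>The path starts in column \<open>j = 0\<close>, and the list position
      \<open>i - 1\<close> is also the abscissa of the left end of the strip.\<close>
    have "horizontal_heights 0 \<tau> ! (i - 1) + slacks a b \<tau> ! (i - 1) = a * (0 + (i - 1)) + b"
      using that by (intro horizontal_heights_plus_slack[OF path]) auto
    then have "real (horizontal_heights 0 \<tau> ! (i - 1)) + real (slacks a b \<tau> ! (i - 1)) =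
        real a * (real i - 1) + real b"
      using that by (simp flip: of_nat_add) (simp add: of_nat_diff)
    then show ?thesis by (simp add: integral_linear_unit_interval)
  qed
  have "area a b n \<tau> = (\<Sum>i=1..n. real (slacks a b \<tau> ! (i - 1)) + real a / 2)"
    unfolding area_def by (rule sum.cong[OF refl strip])
  also have "\<dots> = (\<Sum>i<n. real (slacks a b \<tau> ! i) + real a / 2)"
    by (rule sum.reindex_bij_witness[where i = Suc and j = "\<lambda>i. i - 1"]) auto
  also have "\<dots> = 1 / 2 * real a * real n + real (sum_list (slacks a b \<tau>))"
    using slacks_of_slack_path(2)[OF path]
    by (simp add: sum.distrib sum_list_sum_nth atLeast0LessThan)
  finally show ?thesis .
qed

lemma qpow_add: "qpow (r + s) = qpow r * qpow s"
  by (simp add: qpow_def mult_single)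

lemma slack_seq_iff_nth:
  "slack_seq a u cs \<longleftrightarrow>
     (cs \<noteq> [] \<longrightarrow> cs ! 0 \<le> u) \<and> (\<forall>i. Suc i < length cs \<longrightarrow> cs ! Suc i \<le> cs ! i + a)"
proof (induction a u cs rule: slack_seq.induct)
  case (2 a u c cs)
  \<comment> \<open>Index 0 compares \<open>c\<close> with the head of \<open>cs\<close>; the
    successor indices are the condition on \<open>cs\<close> itself.\<close>
  have "(\<forall>i. P i) \<longleftrightarrow> P 0 \<and> (\<forall>i. P (Suc i))" for P
    by (metis not0_implies_Suc)
  from this[of "\<lambda>i. Suc i < length (c # cs) \<longrightarrow> (c # cs) ! Suc i \<le> (c # cs) ! i + a"]
  show ?case using 2 by (cases cs) auto
qed auto

text \<open>All entries are nonnegative, so \<open>nat\<close> and \<open>int\<close> are mutually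
  inverse here. With \<open>n \<ge> 1\<close>, \<open>c ! 0\<close> is a genuine entry.\<close>

lemma admissible_seqs_eq_image:
  assumes "n \<ge> 1"
  shows "admissible_seqs a b n = map int ` slack_seqs a n b"
proof (intro equalityI subsetI)
  fix c assume c: "c \<in> admissible_seqs a b n"
  have nonneg: "0 \<le> c ! i" if "i < n" for i
    using c that by (cases i) (auto simp: admissible_seqs_def)
  have "c ! Suc i \<le> c ! i + int a" if "Suc i < n" for i
  proof -
    have "Suc i \<in> {1..n - 1}" using that by auto
    then show ?thesis using c unfolding admissible_seqs_def by fastforce
  qed
  then have "slack_seq a b (map nat c)"
    using c nonneg by (auto simp: slack_seq_iff_nth admissible_seqs_def nat_le_iff)
  moreover have "map int (map nat c) = c"
    using c nonneg by (intro nth_equalityI) (auto simp: admissible_seqs_def)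
  ultimately show "c \<in> map int ` slack_seqs a n b"
    using c by (intro image_eqI[of _ _ "map nat c"]) (auto simp: slack_seqs_def admissible_seqs_def)
next
  fix c assume "c \<in> map int ` slack_seqs a n b"
  then obtain cs where cs: "c = map int cs" "length cs = n" "slack_seq a b cs"
    by (auto simp: slack_seqs_def)
  have "int (cs ! i) \<le> int (cs ! (i - 1)) + int a" if "i \<in> {1..n - 1}" for i
    using cs that assms unfolding slack_seq_iff_nth by (cases i) (auto simp flip: of_nat_add)
  then show "c \<in> admissible_seqs a b n"
    using cs assms by (auto simp: admissible_seqs_def slack_seq_iff_nth)
qed

theorem mainTheorem2:
  fixes a b n :: nat
  assumes "n \<ge> 1"
  shows "area_gf a b n =
           qpow (1 / 2 * real a * real n) *
             nested_sum a n b (\<lambda>c. qpow (real (sum_list c)))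
       \<and> card (paths a b n) = card (admissible_seqs a b n)"
proof
  \<comment> \<open>The constant part of each area, \<open>a / 2\<close> per strip, becomes a common
    factor, and only the sum of the slacks depends on the path.\<close>
  have "area_gf a b n =
      (\<Sum>\<tau>\<in>paths a b n. qpow (1 / 2 * real a * real n) * qpow (real (sum_list (slacks a b \<tau>))))"
    unfolding area_gf_def by (rule sum.cong) (simp_all only: area_eq qpow_add)
  also have "\<dots> = (\<Sum>cs\<in>slack_seqs a n b.
      qpow (1 / 2 * real a * real n) * qpow (real (sum_list cs)))"
    by (rule sum.reindex_bij_betw[OF bij_betw_slacks])
  finally show "area_gf a b n =
      qpow (1 / 2 * real a * real n) * nested_sum a n b (\<lambda>c. qpow (real (sum_list c)))"
    by (simp only: nested_sum_eq_sum sum_distrib_left)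
  have "card (paths a b n) = card (slack_seqs a n b)"
    by (rule bij_betw_same_card[OF bij_betw_slacks])
  also have "\<dots> = card (admissible_seqs a b n)"
    unfolding admissible_seqs_eq_image[OF assms]
    by (rule card_image[symmetric]) (simp add: inj_on_def inj_map_eq_map)
  finally show "card (paths a b n) = card (admissible_seqs a b n)" .
qed

end
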